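(* Let $f:\mathbb{R}^n\to\mathbb{R}$ be twice continuously differentiable and level-bounded. Let $\phi:\mathbb{R}^n\to\mathbb{R}\cup\{+\infty\}$ be proper, lower semicontinuous, essentially smooth and strongly convex with constant $\mu_\phi>0$, and suppose moreover that $\phi\ge 0$, $\phi$ is even, and $\phi(0)=0$. Then for every initial point $x_0\in\mathbb{R}^n$ there exists a unique global solution $x:[0,\infty)\to\mathbb{R}^n$ of $$\dot x(t) = -\nabla\phi^*(\nabla f(x(t))),\qquad x(0)=x_0.$$ Moreover, $\dot x\in L^2([0,\infty),\mathbb{R}^n)$, and if in addition $\phi\in\mathcal{C}^2(\operatorname{int}\operatorname{dom}\phi)$, then $\lim_{t\to\infty}\dot x(t)=0$.
   Context: $\|\cdot\|$ and $\langle\cdot,\cdot\rangle$ are the Euclidean norm and inner product on $\mathbb{R}^n$. $\phi^*(y)=\sup_x\{\langle x,y\rangle-\phi(x)\}$ is the convex conjugate; under the assumptions $\phi^*$ is finite and differentiable on $\mathbb{R}^n$ with $1/\mu_\phi$-Lipschitz gradient. $\operatorname{dom}\phi=\{x\mid\phi(x)<\infty\}$. $f$ is level-bounded if $\{x\in\mathbb{R}^n\mid f(x)\le\alpha\}$ is bounded for every $\alpha\in\mathbb{R}$. $\phi$ is even if $\phi(-x)=\phi(x)$ for all $x$. A proper, lower semicontinuous, convex function $\phi$ is essentially smooth if $\operatorname{int}(\operatorname{dom}\phi)\neq\emptyset$, $\phi$ is differentiable on $\operatorname{int}(\operatorname{dom}\phi)$, and $\|\nabla\phi(x^\nu)\|\to\infty$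 whenever $\operatorname{int}(\operatorname{dom}\phi)\ni x^\nu\to x\in\operatorname{bdry}\operatorname{dom}\phi$. $\mathcal{C}^k(Y)$ denotes the $k$ times continuously differentiable functions on the open set $Y$. *)

theory Defs
  imports "HOL-Analysis.Analysis"
begin

definition gradient :: "('a::real_inner \<Rightarrow> real) \<Rightarrow> 'a \<Rightarrow> 'a" where
  "gradient f x = (THE D. GDERIV f x :> D)"

text \<open>Intended for open \<open>Y\<close>: being \<open>k + 1\<close> times continuously differentiable means being
  (Frechet) differentiable with all first partial derivatives \<open>k\<close> times continuously
  differentiable.\<close>

fun C_k_on :: "nat \<Rightarrow> 'a::euclidean_space set \<Rightarrow> ('a \<Rightarrow> real) \<Rightarrow> bool" where
  "C_k_on 0 Y f \<longleftrightarrow> continuous_on Y f"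
| "C_k_on (Suc k) Y f \<longleftrightarrow>
     (\<forall>x\<in>Y. f differentiable (at x)) \<and>
     (\<forall>b\<in>Basis. C_k_on k Y (\<lambda>x. frechet_derivative f (at x) b))"

definition level_bounded :: "('a::real_normed_vector \<Rightarrow> real) \<Rightarrow> bool" where
  "level_bounded f \<longleftrightarrow> (\<forall>\<alpha>. bounded {x. f x \<le> \<alpha>})"

definition effective_domain :: "('a \<Rightarrow> ereal) \<Rightarrow> 'a set" where
  "effective_domain \<phi> = {x. \<phi> x < \<infinity>}"

definition proper :: "('a \<Rightarrow> ereal) \<Rightarrow> bool" where
  "proper \<phi> \<longleftrightarrow> (\<forall>x. \<phi> x \<noteq> -\<infinity>) \<and> effective_domain \<phi> \<noteq> {}"

definition lower_semicontinuous :: "('a::topological_space \<Rightarrow> ereal) \<Rightarrow> bool" where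
  "lower_semicontinuous \<phi> \<longleftrightarrow> (\<forall>x. \<phi> x \<le> Liminf (nhds x) \<phi>)"

text \<open>Only used for functions that never take the value \<open>-\<infinity>\<close>, so that the right-hand
  side is never of the form \<open>\<infinity> - \<infinity>\<close>.\<close>

definition extended_convex :: "('a::real_vector \<Rightarrow> ereal) \<Rightarrow> bool" where
  "extended_convex \<phi> \<longleftrightarrow>
     (\<forall>x y. \<forall>u>0. \<forall>v>0. u + v = 1 \<longrightarrow>
        \<phi> (u *\<^sub>R x + v *\<^sub>R y) \<le> ereal u * \<phi> x + ereal v * \<phi> y)"

definition strongly_convex :: "real \<Rightarrow> ('a::real_inner \<Rightarrow> ereal) \<Rightarrow> bool" where
  "strongly_convex \<mu> \<phi> \<longleftrightarrow> extended_convex (\<lambda>x. \<phi> x - ereal (\<mu> / 2 * (norm x)\<^sup>2))"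

text \<open>Derivatives of an extended-real function are those of its real part; they are only taken
  at points near which the function is finite (\<open>real_of_ereal\<close> maps \<open>\<infinity>\<close> to \<open>0\<close>).\<close>

definition essentially_smooth :: "('a::euclidean_space \<Rightarrow> ereal) \<Rightarrow> bool" where
  "essentially_smooth \<phi> \<longleftrightarrow>
     proper \<phi> \<and> lower_semicontinuous \<phi> \<and> extended_convex \<phi> \<and>
     interior (effective_domain \<phi>) \<noteq> {} \<and>
     (\<forall>x \<in> interior (effective_domain \<phi>). (\<lambda>z. real_of_ereal (\<phi> z)) differentiable (at x)) \<and>
     (\<forall>X x. (\<forall>\<nu>::nat. X \<nu> \<in> interior (effective_domain \<phi>)) \<longrightarrow>
        x \<in> frontier (effective_domain \<phi>) \<longrightarrow> X \<longlonglongrightarrow> x \<longrightarrow>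
        filterlim (\<lambda>\<nu>. norm (gradient (\<lambda>z. real_of_ereal (\<phi> z)) (X \<nu>))) at_top sequentially)"

definition convex_conjugate :: "('a::real_inner \<Rightarrow> ereal) \<Rightarrow> 'a \<Rightarrow> ereal" where
  "convex_conjugate \<phi> y = (SUP x. ereal (x \<bullet> y) - \<phi> x)"

definition global_solution ::
  "('a::real_normed_vector \<Rightarrow> 'a) \<Rightarrow> 'a \<Rightarrow> (real \<Rightarrow> 'a) \<Rightarrow> bool" where
  "global_solution F x0 x \<longleftrightarrow>
     x 0 = x0 \<and> (\<forall>t\<ge>0. (x has_vector_derivative F (x t)) (at t within {0..}))"

definition L2_on :: "real set \<Rightarrow> (real \<Rightarrow> 'a::euclidean_space) \<Rightarrow> bool" where
  "L2_on S g \<longleftrightarrow>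
     set_borel_measurable lebesgue S g \<and> set_integrable lebesgue S (\<lambda>t. (norm (g t))\<^sup>2)"

end

theory Submission
  imports Defs
begin

text \<open>Strong convexity and \<open>\<phi> \<ge> \<phi> 0 = 0\<close> make \<open>\<nabla>\<phi>\<^sup>*(y)\<close> the unique maximizer of \<open>\<langle>x, y\<rangle> - \<phi>(x)\<close>,
  with \<open>1/\<mu>\<close>-Lipschitz dependence on \<open>y\<close> and \<open>\<langle>y, \<nabla>\<phi>\<^sup>*(y)\<rangle> \<ge> \<mu> \<parallel>\<nabla>\<phi>\<^sup>*(y)\<parallel>\<^sup>2\<close>. Hence the vector field is locally
  Lipschitz and \<open>(f \<circ> x)' \<le> - \<mu> \<parallel>x'\<parallel>\<^sup>2\<close>: trajectories stay in a bounded sublevel set, where the field is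
  Lipschitz, which gives global existence and uniqueness, and \<open>x'\<close> is square integrable. Moreover
  \<open>x'\<close> is itself Lipschitz in time, so keeping \<open>\<parallel>x'\<parallel> \<ge> \<epsilon>\<close> at some time costs a fixed amount of the
  energy \<open>f \<circ> x\<close>, which is bounded below; therefore \<open>x'\<close> tends to \<open>0\<close>.\<close>

section \<open>The gradient of the conjugate\<close>

text \<open>The identity \<open>|u a + v b|^2 = u |a|^2 + v |b|^2 - u v |a - b|^2\<close> turns
  convexity of \<open>\<phi>\<close> minus the quadratic into Jensen's inequality for
  \<open>\<phi>\<close> with an explicit gap. Finite values at \<open>a\<close> and \<open>b\<close>
  keep the bound in the reals.\<close>

lemma strongly_convex_finite_ineq:
  assumes sc: "strongly_convex \<mu> \<phi>" and a: "\<phi> a = ereal \<alpha>" and b: "\<phi> b = ereal \<beta>"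
    and uv: "u > 0" "v > 0" "u + v = 1"
  shows "\<phi> (u *\<^sub>R a + v *\<^sub>R b) \<le> ereal (u * \<alpha> + v * \<beta> - \<mu> / 2 * (u * v * (norm (a - b))\<^sup>2))"
proof -
  let ?z = "u *\<^sub>R a + v *\<^sub>R b"
  let ?q = "\<lambda>x. \<mu> / 2 * (norm x)\<^sup>2"
  have v: "v = 1 - u" using uv by simp
  have "\<phi> ?z - ereal (?q ?z) \<le> ereal u * (\<phi> a - ereal (?q a)) + ereal v * (\<phi> b - ereal (?q b))"
    using sc uv unfolding strongly_convex_def extended_convex_def by blast
  then have "\<phi> ?z - ereal (?q ?z) \<le> ereal (u * (\<alpha> - ?q a) + v * (\<beta> - ?q b))"
    by (simp add: a b)
  then have le: "\<phi> ?z \<le> ereal (u * (\<alpha> - ?q a) + v * (\<beta> - ?q b) + ?q ?z)"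
    by (cases "\<phi> ?z") auto
  have "(norm ?z)\<^sup>2 = u * (norm a)\<^sup>2 + v * (norm b)\<^sup>2 - u * v * (norm (a - b))\<^sup>2"
    unfolding power2_norm_eq_inner v
    by (simp add: inner_simps inner_commute[of b a] algebra_simps)
  then have "u * (\<alpha> - ?q a) + v * (\<beta> - ?q b) + ?q ?z
      = u * \<alpha> + v * \<beta> - \<mu> / 2 * (u * v * (norm (a - b))\<^sup>2)"
    by (simp only:) (simp add: field_simps)
  with le show ?thesis by simp
qed

text \<open>An affine minorant touching \<open>\<phi>\<close> at \<open>p\<close> improves to a
  quadratic one: evaluate it at a point of the segment from \<open>p\<close> to \<open>x\<close>,
  compare with the strong convexity gap, divide by the step \<open>u\<close> and let
  \<open>u\<close> tend to 0.\<close>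

lemma strongly_convex_growth:
  assumes sc: "strongly_convex \<mu> \<phi>" and p: "\<phi> p = ereal \<pi>"
    and sub: "\<And>x. ereal (\<pi> + y \<bullet> (x - p)) \<le> \<phi> x"
  shows "ereal (\<pi> + y \<bullet> (x - p) + \<mu> / 2 * (norm (x - p))\<^sup>2) \<le> \<phi> x"
proof (cases "\<phi> x")
  case (real \<xi>)
  let ?d = "(norm (x - p))\<^sup>2"
  \<comment> \<open>The factor \<open>1 - u\<close> is what remains of the gap
    \<open>u (1 - u)\<close> after dividing by \<open>u\<close>; the limit from the right at 0
    removes it.\<close>
  have "\<pi> + y \<bullet> (x - p) + \<mu> / 2 * ((1 - u) * ?d) \<le> \<xi>" if u: "0 < u" "u < 1" for u
  proof -
    have z: "u *\<^sub>R x + (1 - u) *\<^sub>R p - p = u *\<^sub>R (x - p)"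
      by (simp add: algebra_simps)
    have "ereal (\<pi> + y \<bullet> (u *\<^sub>R (x - p)))
        \<le> ereal (u * \<xi> + (1 - u) * \<pi> - \<mu> / 2 * (u * (1 - u) * ?d))"
      using order_trans[OF sub[of "u *\<^sub>R x + (1 - u) *\<^sub>R p"]
        strongly_convex_finite_ineq[OF sc real p, of u "1 - u"]] u
      unfolding z by simp
    then have "u * (\<pi> + y \<bullet> (x - p) + \<mu> / 2 * ((1 - u) * ?d)) \<le> u * \<xi>"
      by (simp add: algebra_simps)
    then show ?thesis using u by simp
  qed
  then have "\<forall>\<^sub>F u in at_right 0. \<pi> + y \<bullet> (x - p) + \<mu> / 2 * ((1 - u) * ?d) \<le> \<xi>"
    unfolding eventually_at_right_field by (intro exI[of _ 1]) simp
  moreover have "((\<lambda>u. \<pi> + y \<bullet> (x - p) + \<mu> / 2 * ((1 - u) * ?d)) \<longlongrightarrow>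
      \<pi> + y \<bullet> (x - p) + \<mu> / 2 * ((1 - 0) * ?d)) (at_right 0)"
    by (intro tendsto_intros)
  ultimately have "\<pi> + y \<bullet> (x - p) + \<mu> / 2 * ((1 - 0) * ?d) \<le> \<xi>"
    by (intro tendsto_upperbound) auto
  then show ?thesis by (simp add: real)
qed (use sub[of x] in auto)

text \<open>The point \<open>p\<close> is a maximizer of \<open>y \<bullet> x - \<phi> x\<close>,
  stated as \<open>y\<close> being a subgradient of \<open>\<phi>\<close> at \<open>p\<close>. This
  is the direct method: quadratic growth bounds a maximizing sequence, and lower semicontinuity
  handles the limit of a subsequence.\<close>

lemma subgradient_point_exists:
  fixes \<phi> :: "'a::euclidean_space \<Rightarrow> ereal"
  assumes lsc: "lower_semicontinuous \<phi>" and "\<mu> > 0" and "\<phi> 0 = 0"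
    and quad: "\<And>x. ereal (\<mu> / 2 * (norm x)\<^sup>2) \<le> \<phi> x"
  shows "\<exists>p \<pi>. \<phi> p = ereal \<pi> \<and> (\<forall>x. ereal (\<pi> + y \<bullet> (x - p)) \<le> \<phi> x)"
proof -
  \<comment> \<open>Only finite values of \<open>\<phi>\<close> enter, so the supremum of
    \<open>V\<close> is a real number; it is the conjugate at \<open>y\<close>.\<close>
  define V where "V = {y \<bullet> x - \<xi> |x \<xi>. \<phi> x = ereal \<xi>}"
  have bound: "y \<bullet> x - \<xi> \<le> norm x * (norm y - \<mu> / 2 * norm x)" if "\<phi> x = ereal \<xi>" for x \<xi>
  proof -
    have "\<mu> / 2 * (norm x)\<^sup>2 \<le> \<xi>"
      using quad[of x] unfolding that by simp
    then have "y \<bullet> x - \<xi> \<le> norm y * norm x - \<mu> / 2 * (norm x)\<^sup>2"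
      using norm_cauchy_schwarz[of y x] by linarith
    also have "\<dots> = norm x * (norm y - \<mu> / 2 * norm x)"
      by (simp add: power2_eq_square algebra_simps)
    finally show ?thesis .
  qed
  have ub: "s \<le> (norm y)\<^sup>2 / \<mu>" if "s \<in> V" for s
  proof -
    from that obtain x \<xi> where x: "\<phi> x = ereal \<xi>" "s = y \<bullet> x - \<xi>"
      by (auto simp: V_def)
    \<comment> \<open>Completing the square; the constant obtained is not sharp, but it makes
      \<open>V\<close> bounded above.\<close>
    have "0 \<le> (norm y - \<mu> * norm x / 2)\<^sup>2" by simp
    then have "norm x * (norm y - \<mu> / 2 * norm x) * \<mu> \<le> (norm y)\<^sup>2"
      using zero_le_power2[of "\<mu> * norm x"]
      by (simp add: power2_eq_square algebra_simps)
    then have "norm x * (norm y - \<mu> / 2 * norm x) \<le> (norm y)\<^sup>2 / \<mu>"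
      using \<open>\<mu> > 0\<close> by (simp add: field_simps)
    with bound[OF x(1)] x(2) show ?thesis by simp
  qed
  have V0: "0 \<in> V" unfolding V_def using \<open>\<phi> 0 = 0\<close> by (intro CollectI exI[of _ 0])
      (simp only: inner_zero_right zero_ereal_def, simp)
  have bdd: "bdd_above V" using ub by (rule bdd_aboveI)
  define s where "s = Sup V"
  have s_ge: "y \<bullet> x - \<xi> \<le> s" if "\<phi> x = ereal \<xi>" for x \<xi>
    unfolding s_def using that bdd by (intro cSup_upper) (auto simp: V_def)
  have "\<exists>x \<xi>. \<phi> x = ereal \<xi> \<and> s - inverse (Suc k) < y \<bullet> x - \<xi>" for k
  proof -
    have "\<exists>w\<in>V. s - inverse (Suc k) < w"
      unfolding s_def using V0 bdd by (subst less_cSup_iff[symmetric]) auto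
    then show ?thesis unfolding V_def by blast
  qed
  then obtain X \<Xi> where X: "\<And>k. \<phi> (X k) = ereal (\<Xi> k)"
    and Xs: "\<And>k. s - inverse (Suc k) < y \<bullet> X k - \<Xi> k" by metis
  have "s \<ge> 0" unfolding s_def using V0 bdd by (rule cSup_upper)
  \<comment> \<open>Beyond this radius the estimate \<open>bound\<close> forces the objective to at
    most -1, whereas along the sequence it exceeds \<open>s - 1\<close>, which is at least
    -1.\<close>
  have "norm (X k) \<le> 2 * (norm y + 1) / \<mu> + 1" for k
  proof (rule ccontr)
    assume *: "\<not> ?thesis"
    then have n: "norm (X k) > 2 * (norm y + 1) / \<mu> + 1" by simp
    then have "norm (X k) > 2 * (norm y + 1) / \<mu>" by simp
    then have "norm y - \<mu> / 2 * norm (X k) < -1" using \<open>\<mu> > 0\<close> by (simp add: field_simps)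
    moreover have n1: "norm (X k) \<ge> 1" using n \<open>\<mu> > 0\<close>
      by (smt (verit) divide_nonneg_pos norm_ge_zero)
    ultimately have "norm (X k) * (norm y - \<mu> / 2 * norm (X k)) \<le> norm (X k) * (-1)"
      by (intro mult_left_mono) auto
    then have "y \<bullet> X k - \<Xi> k \<le> -1" using bound[OF X[of k]] n1 by simp
    moreover have "inverse (real (Suc k)) \<le> 1" by (simp add: field_simps)
    ultimately show False using Xs[of k] \<open>s \<ge> 0\<close> by simp
  qed
  then have "bounded (range X)" by (auto intro: boundedI)
  then obtain p r where r: "strict_mono (r :: nat \<Rightarrow> nat)" and lim: "(X \<circ> r) \<longlonglongrightarrow> p"
    using bounded_imp_convergent_subsequence by blast
  have gap: "(\<lambda>k. y \<bullet> X (r k) - s + inverse (Suc (r k))) \<longlonglongrightarrow> y \<bullet> p - s + 0"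
    using lim LIMSEQ_subseq_LIMSEQ[OF LIMSEQ_inverse_real_of_nat r]
    by (intro tendsto_intros) (auto simp: o_def)
  \<comment> \<open>A priori \<open>\<phi> p\<close> may be infinite, so lower semicontinuity is
    tested against real \<open>c\<close> below \<open>\<phi> p\<close>: eventually \<open>c\<close>
    lies below the values of \<open>\<phi>\<close> on the subsequence, which are controlled by
    \<open>gap\<close>.\<close>
  have c: "c \<le> y \<bullet> p - s" if "ereal c < \<phi> p" for c
  proof -
    have "\<forall>\<^sub>F x in nhds p. ereal c < \<phi> x"
      using lsc that unfolding lower_semicontinuous_def le_Liminf_iff by blast
    then have "\<forall>\<^sub>F k in sequentially. ereal c < \<phi> ((X \<circ> r) k)"
      using lim by (rule eventually_compose_filterlim)
    then have "\<forall>\<^sub>F k in sequentially. c \<le> y \<bullet> X (r k) - s + inverse (Suc (r k))"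
    proof (rule eventually_mono)
      fix k assume "ereal c < \<phi> ((X \<circ> r) k)"
      then show "c \<le> y \<bullet> X (r k) - s + inverse (Suc (r k))"
        using Xs[of "r k"] by (simp add: X)
    qed
    with gap show ?thesis using tendsto_lowerbound by fastforce
  qed
  have "\<phi> p \<le> ereal (y \<bullet> p - s)"
  proof (rule ccontr)
    assume "\<not> ?thesis"
    then obtain c where "ereal (y \<bullet> p - s) < ereal c" "ereal c < \<phi> p"
      using ereal_dense2 by (meson not_le)
    with c[of c] show False by simp
  qed
  moreover have "\<phi> p \<ge> 0"
    using \<open>\<mu> > 0\<close> by (intro order_trans[OF _ quad[of p]]) simp
  ultimately obtain \<pi> where \<pi>: "\<phi> p = ereal \<pi>" "\<pi> \<le> y \<bullet> p - s" by (cases "\<phi> p") auto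
  have "ereal (\<pi> + y \<bullet> (x - p)) \<le> \<phi> x" for x
  proof (cases "\<phi> x")
    case (real \<xi>)
    then show ?thesis using s_ge[OF real] \<pi>(2) by (simp add: inner_diff_right)
  next
    case MInf
    then show ?thesis using quad[of x] by simp
  qed simp
  with \<pi>(1) show ?thesis by blast
qed

section \<open>Differentiability of the conjugate\<close>

lemma GDERIV_unique:
  assumes "GDERIV f x :> a" "GDERIV f x :> b"
  shows "a = b"
proof -
  have "(\<lambda>h. h \<bullet> a) = (\<lambda>h. h \<bullet> b)"
    using assms unfolding gderiv_def by (rule has_derivative_unique)
  then show ?thesis by (metis inner_commute vector_eq_ldot)
qed

lemma gradient_eqI: "GDERIV f x :> D \<Longrightarrow> gradient f x = D"
  unfolding gradient_def by (blast intro: the_equality GDERIV_unique)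

text \<open>Let \<open>Q y\<close> be a maximizer for \<open>y\<close>. Quadratic growth at two such
  points gives strong monotonicity of \<open>Q\<close>, hence the Lipschitz bound; this bound in
  turn shows that \<open>Q\<close> is the gradient of the conjugate.\<close>

lemma convex_conjugate_gradient:
  fixes \<phi> :: "'a::euclidean_space \<Rightarrow> ereal"
  assumes sc: "strongly_convex \<mu> \<phi>" and lsc: "lower_semicontinuous \<phi>" and \<mu>: "\<mu> > 0"
    and nonneg: "\<And>x. \<phi> x \<ge> 0" and zero: "\<phi> 0 = 0"
  defines "P \<equiv> gradient (\<lambda>y. real_of_ereal (convex_conjugate \<phi> y))"
  shows "\<mu> * (norm (P y))\<^sup>2 \<le> y \<bullet> P y"
    and "norm (P y - P z) \<le> norm (y - z) / \<mu>"
proof -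
  let ?h = "\<lambda>y. real_of_ereal (convex_conjugate \<phi> y)"
  \<comment> \<open>Since \<open>\<phi>\<close> has its minimum 0 at 0, the zero vector is a
    subgradient there.\<close>
  have quad: "ereal (\<mu> / 2 * (norm x)\<^sup>2) \<le> \<phi> x" for x
    using strongly_convex_growth[OF sc, of 0 0 0 x] nonneg zero by (simp add: zero_ereal_def)
  obtain Q \<pi> where Q: "\<And>y. \<phi> (Q y) = ereal (\<pi> y)"
    and sub: "\<And>y x. ereal (\<pi> y + y \<bullet> (x - Q y)) \<le> \<phi> x"
    using subgradient_point_exists[OF lsc \<mu> zero quad] by metis
  have growth: "ereal (\<pi> y + y \<bullet> (x - Q y) + \<mu> / 2 * (norm (x - Q y))\<^sup>2) \<le> \<phi> x" for y x
    using strongly_convex_growth[OF sc Q sub] .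
  have conj: "convex_conjugate \<phi> y = ereal (Q y \<bullet> y - \<pi> y)" for y
    unfolding convex_conjugate_def
  proof (rule antisym)
    show "(SUP x. ereal (x \<bullet> y) - \<phi> x) \<le> ereal (Q y \<bullet> y - \<pi> y)"
    proof (rule SUP_least)
      fix x
      show "ereal (x \<bullet> y) - \<phi> x \<le> ereal (Q y \<bullet> y - \<pi> y)"
        using sub[of y x] by (cases "\<phi> x") (auto simp: inner_simps inner_commute)
    qed
    show "ereal (Q y \<bullet> y - \<pi> y) \<le> (SUP x. ereal (x \<bullet> y) - \<phi> x)"
      by (rule SUP_upper2[of "Q y"]) (auto simp: Q)
  qed
  \<comment> \<open>Adding the two growth inequalities cancels \<open>\<pi> y\<close> and
    \<open>\<pi> z\<close>, and the two halves of \<open>\<mu>\<close> add up.\<close>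
  have mono: "\<mu> * (norm (Q y - Q z))\<^sup>2 \<le> (y - z) \<bullet> (Q y - Q z)" for y z
    using growth[of y "Q z"] growth[of z "Q y"] norm_minus_commute[of "Q y" "Q z"]
    by (simp add: Q inner_simps algebra_simps)
  have lip: "norm (Q y - Q z) \<le> norm (y - z) / \<mu>" for y z
  proof (cases "Q y = Q z")
    case False
    have "norm (Q y - Q z) * (\<mu> * norm (Q y - Q z)) \<le> norm (Q y - Q z) * norm (y - z)"
      using mono[of y z] norm_cauchy_schwarz[of "y - z" "Q y - Q z"]
      by (simp add: power2_eq_square algebra_simps)
    then have "\<mu> * norm (Q y - Q z) \<le> norm (y - z)" using False by simp
    then show ?thesis using \<mu> by (simp add: field_simps)
  qed (use \<mu> in simp)
  have G: "GDERIV ?h y :> Q y" for y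
    unfolding gderiv_def has_derivative_iff_norm
  proof (intro conjI)
    show "bounded_linear (\<lambda>h. h \<bullet> Q y)" by (rule bounded_linear_inner_left)
    \<comment> \<open>The subgradient inequality at \<open>z\<close> bounds the remainder below by
      0; the one at \<open>y\<close> bounds it above by
      \<open>(z - y) \<bullet> (Q z - Q y)\<close>, which is quadratically small because
      \<open>Q\<close> is Lipschitz.\<close>
    have est: "norm (norm (?h z - ?h y - (z - y) \<bullet> Q y) / norm (z - y)) \<le> norm (z - y) / \<mu>" for z
    proof -
      have l: "0 \<le> ?h z - ?h y - (z - y) \<bullet> Q y"
        using sub[of z "Q y"] by (simp add: Q conj inner_simps inner_commute)
      have "?h z - ?h y - (z - y) \<bullet> Q y \<le> (z - y) \<bullet> (Q z - Q y)"
        using sub[of y "Q z"] by (simp add: Q conj inner_simps inner_commute)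
      also have "\<dots> \<le> norm (z - y) * norm (Q z - Q y)" by (rule norm_cauchy_schwarz)
      also have "\<dots> \<le> norm (z - y) * (norm (z - y) / \<mu>)"
        using lip by (intro mult_left_mono) auto
      finally show ?thesis using l \<mu> by (cases "z = y") (auto simp: field_simps)
    qed
    show "((\<lambda>z. norm (?h z - ?h y - (z - y) \<bullet> Q y) / norm (z - y)) \<longlongrightarrow> 0) (at y)"
    proof (rule Lim_null_comparison)
      show "\<forall>\<^sub>F z in at y. norm (norm (?h z - ?h y - (z - y) \<bullet> Q y) / norm (z - y)) \<le> norm (z - y) / \<mu>"
        using est by simp
      show "((\<lambda>z. norm (z - y) / \<mu>) \<longlongrightarrow> 0) (at y)"
        using \<mu> by (auto intro!: tendsto_eq_intros)
    qed
  qed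
  have PQ: "P = Q" unfolding P_def using G by (auto intro: gradient_eqI)
  \<comment> \<open>Growth is used twice, from 0 to \<open>Q y\<close> and from \<open>Q y\<close>
    back to 0; adding the two eliminates \<open>\<pi> y\<close>.\<close>
  have "\<mu> / 2 * (norm (Q y))\<^sup>2 \<le> \<pi> y"
    using quad[of "Q y"] by (simp add: Q)
  moreover have "\<pi> y - y \<bullet> Q y + \<mu> / 2 * (norm (Q y))\<^sup>2 \<le> 0"
    using growth[of y 0] by (simp add: zero zero_ereal_def inner_simps)
  ultimately show "\<mu> * (norm (P y))\<^sup>2 \<le> y \<bullet> P y" by (simp add: PQ)
  show "norm (P y - P z) \<le> norm (y - z) / \<mu>" using lip by (simp add: PQ)
qed

section \<open>Local Lipschitz continuity of the gradient of a twice continuously differentiable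
  function\<close>

text \<open>The second claim writes the gradient through the partial derivatives, the only objects
  whose regularity \<open>C_k_on\<close> speaks about.\<close>

lemma C_k_on_2_GDERIV:
  fixes f :: "'a::euclidean_space \<Rightarrow> real"
  assumes "C_k_on 2 UNIV f"
  shows "GDERIV f x :> gradient f x"
    and "gradient f x = (\<Sum>b\<in>Basis. frechet_derivative f (at x) b *\<^sub>R b)"
proof -
  have d: "(f has_derivative frechet_derivative f (at x)) (at x)"
    using assms by (simp add: numeral_2_eq_2 frechet_derivative_works[symmetric])
  let ?D = "\<Sum>b\<in>Basis. frechet_derivative f (at x) b *\<^sub>R b"
  interpret linear "frechet_derivative f (at x)"
    using has_derivative_linear[OF d] .
  have "frechet_derivative f (at x) h = h \<bullet> ?D" for h
  proof -
    have "frechet_derivative f (at x) h = frechet_derivative f (at x) (\<Sum>b\<in>Basis. (h \<bullet> b) *\<^sub>R b)"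
      by (simp add: euclidean_representation)
    also have "\<dots> = h \<bullet> ?D"
      by (simp add: sum scale inner_sum_right algebra_simps)
    finally show ?thesis .
  qed
  then have G: "GDERIV f x :> ?D"
    unfolding gderiv_def by (intro has_derivative_eq_rhs[OF d] ext)
  show "gradient f x = ?D" using G by (rule gradient_eqI)
  with G show "GDERIV f x :> gradient f x" by (simp only:)
qed

text \<open>Continuous partial derivatives are bounded on the compact ball, and the ball is convex,
  so the mean value inequality applies.\<close>

lemma C_1_lipschitz_on_cball:
  fixes g :: "'a::euclidean_space \<Rightarrow> real"
  assumes g: "C_k_on (Suc 0) UNIV g"
  shows "\<exists>L. L-lipschitz_on (cball 0 R) g"
proof -
  let ?D = "\<lambda>x. frechet_derivative g (at x)"
  have d: "(g has_derivative ?D x) (at x)" for x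
    using g by (simp add: frechet_derivative_works[symmetric])
  have c: "continuous_on UNIV (\<lambda>x. ?D x b)" if "b \<in> Basis" for b
    using g that by simp
  \<comment> \<open>The sum of the absolute partial derivatives dominates the operator norm of the
    derivative, because coordinates of \<open>h\<close> are at most \<open>norm h\<close>.\<close>
  have "continuous_on (cball 0 R) (\<lambda>x. \<Sum>b\<in>Basis. \<bar>?D x b\<bar>)"
    by (intro continuous_intros continuous_on_subset[OF c]) auto
  then have "compact ((\<lambda>x. \<Sum>b\<in>Basis. \<bar>?D x b\<bar>) ` cball 0 R)"
    by (rule compact_continuous_image) simp
  then have "bounded ((\<lambda>x. \<Sum>b\<in>Basis. \<bar>?D x b\<bar>) ` cball 0 R)" by (rule compact_imp_bounded)
  then obtain B where B: "B > 0" "\<And>x. x \<in> cball 0 R \<Longrightarrow> \<bar>\<Sum>b\<in>Basis. \<bar>?D x b\<bar>\<bar> \<le> B"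
    unfolding bounded_pos by auto
  have "onorm (?D x) \<le> B" if "x \<in> cball 0 R" for x
  proof (rule onorm_bound)
    fix h
    interpret linear "?D x" using has_derivative_linear[OF d] .
    have "?D x h = ?D x (\<Sum>b\<in>Basis. (h \<bullet> b) *\<^sub>R b)" by (simp add: euclidean_representation)
    also have "\<dots> = (\<Sum>b\<in>Basis. (h \<bullet> b) * ?D x b)" by (simp add: sum scale)
    finally have "norm (?D x h) \<le> (\<Sum>b\<in>Basis. \<bar>(h \<bullet> b) * ?D x b\<bar>)" by simp
    also have "\<dots> \<le> (\<Sum>b\<in>Basis. norm h * \<bar>?D x b\<bar>)"
      by (intro sum_mono) (auto simp: abs_mult Basis_le_norm intro!: mult_right_mono)
    also have "\<dots> = (\<Sum>b\<in>Basis. \<bar>?D x b\<bar>) * norm h" by (simp add: sum_distrib_left mult.commute)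
    also have "\<dots> \<le> B * norm h" using B(2)[OF that] by (intro mult_right_mono) auto
    finally show "norm (?D x h) \<le> B * norm h" .
  qed (use B in auto)
  then have "norm (g x - g y) \<le> B * norm (x - y)" if "x \<in> cball 0 R" "y \<in> cball 0 R" for x y
    using that d by (intro differentiable_bound[of "cball 0 R" g ?D])
      (auto intro: has_derivative_at_withinI)
  then show ?thesis using B(1)
    by (auto intro!: exI[of _ B] lipschitz_onI simp: dist_norm)
qed

lemma C_2_gradient_lipschitz_on_cball:
  fixes f :: "'a::euclidean_space \<Rightarrow> real"
  assumes f: "C_k_on 2 UNIV f"
  shows "\<exists>L. L-lipschitz_on (cball 0 R) (gradient f)"
proof -
  have "\<exists>L. L-lipschitz_on (cball 0 R) (\<lambda>x. frechet_derivative f (at x) b)" if "b \<in> Basis" for b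
    using f that by (intro C_1_lipschitz_on_cball) (auto simp: numeral_2_eq_2)
  then obtain L where L: "\<And>b. b \<in> Basis \<Longrightarrow>
      (L b)-lipschitz_on (cball 0 R) (\<lambda>x. frechet_derivative f (at x) b)"
    by metis
  have "(\<Sum>b\<in>Basis. L b)-lipschitz_on (cball 0 R) (gradient f)"
  proof (rule lipschitz_onI)
    fix x y :: 'a assume xy: "x \<in> cball 0 R" "y \<in> cball 0 R"
    have "dist (gradient f x) (gradient f y)
        = norm (\<Sum>b\<in>Basis. (frechet_derivative f (at x) b - frechet_derivative f (at y) b) *\<^sub>R b)"
      by (simp add: C_k_on_2_GDERIV(2)[OF f] dist_norm sum_subtractf scaleR_diff_left)
    also have "\<dots> \<le> (\<Sum>b\<in>Basis. L b * dist x y)"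
      using lipschitz_onD[OF L xy] by (intro sum_norm_le) (simp add: dist_real_def)
    finally show "dist (gradient f x) (gradient f y) \<le> (\<Sum>b\<in>Basis. L b) * dist x y"
      by (simp add: sum_distrib_right)
  next
    show "0 \<le> sum L Basis" using lipschitz_on_nonneg[OF L] by (rule sum_nonneg)
  qed
  then show ?thesis by blast
qed

section \<open>Dissipative flows\<close>

lemma integral_has_vector_derivative_atLeast:
  fixes g :: "real \<Rightarrow> 'a::banach"
  assumes g: "continuous_on {0..} g" and "t \<ge> 0"
  shows "((\<lambda>t. integral {0..t} g) has_vector_derivative g t) (at t within {0..})"
proof -
  have "((\<lambda>t. integral {0..t} g) has_vector_derivative g t) (at t within {0..t+1})"
    using \<open>t \<ge> 0\<close> by (intro integral_has_vector_derivative continuous_on_subset[OF g]) auto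
  moreover have "at t within {0..t+1} = at t within {0..}"
    by (rule at_within_nhd[of t "{..<t+1}"]) auto
  ultimately show ?thesis by simp
qed

text \<open>Picard's integral operator has a fixed point by Banach's theorem. Boundedness of
  \<open>G\<close> lets its values grow at most linearly, so the exponential weight brings them into
  the bounded continuous functions.\<close>

lemma global_solution_exists_bounded_lipschitz:
  fixes G :: "'a::euclidean_space \<Rightarrow> 'a"
  assumes lip: "L-lipschitz_on UNIV G" and bnd: "\<And>x. norm (G x) \<le> M"
  shows "\<exists>x. global_solution G x0 x"
proof -
  \<comment> \<open>Any \<open>K\<close> above \<open>L\<close> makes \<open>L / K\<close> a
    contraction factor; adding 1 also keeps \<open>K\<close> positive when \<open>L\<close> is
    0.\<close>
  define K where "K = L + 1"
  have L: "L \<ge> 0" using lip by (rule lipschitz_on_nonneg)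
  then have K: "K > 0" "L / K < 1" "L / K \<ge> 0" by (auto simp: K_def)
  have M: "M \<ge> 0" using bnd[of 0] norm_ge_zero order_trans by blast
  define g where "g u s = G (x0 + exp (K * s) *\<^sub>R u s)" for u :: "real \<Rightarrow> 'a" and s
  define I where "I u t = integral {0..t} (g u)" for u t
  \<comment> \<open>\<open>u\<close> stands for \<open>exp (- K t) (x t - x0)\<close>: with this weight, which plays the role of
    Bielecki's norm, the Picard operator contracts on the whole half-line.\<close>
  define T where "T u t = exp (- K * max 0 t) *\<^sub>R I u (max 0 t)" for u t
  have gc: "continuous_on S (g u)" if "continuous_on UNIV u" for u S
    unfolding g_def
    by (intro continuous_on_compose2[OF lipschitz_on_continuous_on[OF lip]] continuous_intros
        continuous_on_subset[OF that]) auto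
  have I_bound: "norm (I u t) \<le> M * t" if "continuous_on UNIV u" "t \<ge> 0" for u t
    unfolding I_def using integral_bound[of 0 t "g u" M] that gc[OF that(1)] bnd
    by (simp add: g_def)
  \<comment> \<open>The type of bounded continuous functions lives on the whole real line;
    \<open>max 0 t\<close> extends \<open>T u\<close> to negative times by its value at 0.\<close>
  have T_in: "T u \<in> bcontfun" if u: "continuous_on UNIV u" for u
  proof (rule bcontfun_normI)
    have "continuous_on {0..} (I u)"
      unfolding I_def continuous_on_eq_continuous_within
      using integral_has_vector_derivative_atLeast[OF gc[OF u]]
      by (auto intro: has_vector_derivative_continuous)
    moreover have "continuous_on UNIV (\<lambda>t::real. max 0 t)" by (intro continuous_intros)
    ultimately have "continuous_on UNIV (\<lambda>t. I u (max 0 t))"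
      by (rule continuous_on_compose2) auto
    then show "continuous_on UNIV (T u)"
      unfolding T_def by (intro continuous_intros)
    fix t :: real
    define r where "r = max 0 t"
    have r: "r \<ge> 0" by (simp add: r_def)
    have "K * r \<le> exp (K * r)" using exp_ge_add_one_self[of "K * r"] by linarith
    then have "r * exp (- K * r) \<le> 1 / K"
      using K by (simp add: exp_minus field_simps)
    then have "M * (r * exp (- K * r)) \<le> M * (1 / K)" using M by (rule mult_left_mono)
    moreover have "norm (T u t) \<le> exp (- K * r) * (M * r)"
      using I_bound[OF u r] by (simp add: T_def r_def[symmetric])
    ultimately show "norm (T u t) \<le> M / K" by (simp add: algebra_simps)
  qed
  define \<Phi> where "\<Phi> u = Bcontfun (T (apply_bcontfun u))" for u
  have \<Phi>: "apply_bcontfun (\<Phi> u) = T (apply_bcontfun u)" for u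
    unfolding \<Phi>_def by (rule Bcontfun_inverse) (simp add: T_in)
  have "dist (\<Phi> u) (\<Phi> v) \<le> L / K * dist u v" for u v
  proof (rule dist_bound)
    fix t :: real
    define r where "r = max 0 t"
    have r: "r \<ge> 0" by (simp add: r_def)
    define d where "d = dist u v"
    have ci: "g (apply_bcontfun w) integrable_on {0..r}" for w
      by (intro integrable_continuous_real gc) simp
    \<comment> \<open>Integrating the weight produces the factor \<open>1 / K\<close>, the source of
      the contraction.\<close>
    have E: "((\<lambda>s. L * d * exp (K * s)) has_integral L * d * exp (K * r) / K - L * d * exp (K * 0) / K) {0..r}"
      using r K by (intro fundamental_theorem_of_calculus)
        (auto intro!: derivative_eq_intros simp: has_real_derivative_iff_has_vector_derivative[symmetric])
    have "norm (g u s - g v s) \<le> L * d * exp (K * s)" for s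
    proof -
      have "norm (g u s - g v s) \<le> L * norm (exp (K * s) *\<^sub>R u s - exp (K * s) *\<^sub>R v s)"
        using lipschitz_onD[OF lip, of "x0 + exp (K * s) *\<^sub>R u s" "x0 + exp (K * s) *\<^sub>R v s"]
        by (simp add: g_def dist_norm)
      also have "\<dots> = L * (exp (K * s) * dist (u s) (v s))"
        by (simp add: scaleR_diff_right[symmetric] dist_norm)
      also have "\<dots> \<le> L * (exp (K * s) * d)"
        unfolding d_def using L dist_bounded[of u s v] by (intro mult_left_mono) auto
      finally show ?thesis by (simp add: mult_ac)
    qed
    then have "norm (integral {0..r} (\<lambda>s. g u s - g v s)) \<le> integral {0..r} (\<lambda>s. L * d * exp (K * s))"
      using E ci by (intro integral_norm_bound_integral integrable_diff) auto
    then have "norm (I u r - I v r) \<le> L * d * exp (K * r) / K - L * d / K"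
      using ci integral_unique[OF E] by (simp add: I_def integral_diff)
    also have "\<dots> \<le> L * d * exp (K * r) / K"
      using L K by (simp add: d_def)
    finally have "exp (- K * r) * norm (I u r - I v r) \<le> exp (- K * r) * (L * d * exp (K * r) / K)"
      by (intro mult_left_mono) auto
    also have "\<dots> = L / K * d" by (simp add: exp_minus)
    finally show "dist (\<Phi> u t) (\<Phi> v t) \<le> L / K * dist u v"
      by (simp add: \<Phi> T_def r_def[symmetric] d_def dist_norm scaleR_diff_right[symmetric])
  qed
  then obtain u where u: "\<Phi> u = u"
    using banach_fix_type[OF K(3,2), of \<Phi>] by blast
  \<comment> \<open>Undoing the weight turns the fixed point equation into the integral equation for
    \<open>x\<close>.\<close>
  define x where "x t = x0 + exp (K * t) *\<^sub>R u t" for t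
  have gx: "g u = (\<lambda>s. G (x s))" by (simp add: fun_eq_iff g_def x_def)
  have x: "x t = x0 + integral {0..t} (g u)" if "t \<ge> 0" for t
  proof -
    have "u t = T u t" using \<Phi>[of u] u by simp
    then have "exp (K * t) *\<^sub>R u t = I u t"
      using that by (simp add: T_def exp_minus)
    then show ?thesis by (simp add: x_def I_def)
  qed
  have "(x has_vector_derivative G (x t)) (at t within {0..})" if "t \<ge> 0" for t
  proof (rule has_vector_derivative_transform[of t "{0..}" x "\<lambda>t. x0 + integral {0..t} (g u)"])
    have "((\<lambda>t. integral {0..t} (g u)) has_vector_derivative g u t) (at t within {0..})"
      using that by (intro integral_has_vector_derivative_atLeast gc) auto
    then show "((\<lambda>t. x0 + integral {0..t} (g u)) has_vector_derivative G (x t)) (at t within {0..})"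
      by (auto intro!: derivative_eq_intros simp: gx)
  qed (use that x in auto)
  moreover have "x 0 = x0" using x[of 0] by simp
  ultimately show ?thesis unfolding global_solution_def by blast
qed

section \<open>Energy along trajectories and uniqueness\<close>

lemma global_solution_continuous:
  "global_solution F x0 x \<Longrightarrow> continuous_on {0..} x"
  unfolding global_solution_def continuous_on_eq_continuous_within
  by (auto intro: has_vector_derivative_continuous)

lemma has_integral_within_atLeast:
  fixes V :: "real \<Rightarrow> 'a::banach"
  assumes "0 \<le> a" "a \<le> b"
    and "\<And>t. a \<le> t \<Longrightarrow> t \<le> b \<Longrightarrow> (V has_vector_derivative D t) (at t within {0..})"
  shows "(D has_integral V b - V a) {a..b}"
proof (rule fundamental_theorem_of_calculus[OF \<open>a \<le> b\<close>])
  fix t assume "t \<in> {a..b}"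
  then show "(V has_vector_derivative D t) (at t within {a..b})"
    using assms(1) by (intro has_vector_derivative_within_subset[OF assms(3)]) auto
qed

lemma energy_has_integral:
  assumes grad: "\<And>x. GDERIV f x :> g x" and "0 \<le> a" "a \<le> b"
    and x: "\<And>t. a \<le> t \<Longrightarrow> t \<le> b \<Longrightarrow> (x has_vector_derivative F (x t)) (at t within {0..})"
  shows "((\<lambda>t. F (x t) \<bullet> g (x t)) has_integral f (x b) - f (x a)) {a..b}"
proof (rule has_integral_within_atLeast[OF assms(2,3)])
  fix t :: real assume "a \<le> t" "t \<le> b"
  from has_derivative_compose[OF x[OF this, unfolded has_vector_derivative_def]
      grad[unfolded gderiv_def]]
  show "((\<lambda>t. f (x t)) has_vector_derivative F (x t) \<bullet> g (x t)) (at t within {0..})"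
    by (simp add: has_vector_derivative_def)
qed

text \<open>With \<open>c = 0\<close> this is monotonicity of the energy, with \<open>c > 0\<close>
  a definite drop. The equation is required on \<open>{a..b}\<close> only, so that the lemma applies
  up to an exit time.\<close>

lemma energy_decrease:
  assumes grad: "\<And>x. GDERIV f x :> g x" and "0 \<le> a" "a \<le> b"
    and x: "\<And>t. a \<le> t \<Longrightarrow> t \<le> b \<Longrightarrow> (x has_vector_derivative F (x t)) (at t within {0..})"
    and diss: "\<And>x. \<mu> * (norm (F x))\<^sup>2 \<le> - (F x \<bullet> g x)"
    and c: "\<And>t. a \<le> t \<Longrightarrow> t \<le> b \<Longrightarrow> c \<le> \<mu> * (norm (F (x t)))\<^sup>2"
  shows "f (x b) \<le> f (x a) - c * (b - a)"
proof -
  have const: "((\<lambda>t. - c) has_integral (b - a) *\<^sub>R (- c)) {a..b}"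
    using has_integral_const_real[of "-c" a b] \<open>a \<le> b\<close> by simp
  have "f (x b) - f (x a) \<le> (b - a) *\<^sub>R (- c)"
  proof (rule has_integral_le[OF energy_has_integral[OF grad assms(2,3) x] const])
    fix t assume "t \<in> {a..b}"
    then show "F (x t) \<bullet> g (x t) \<le> - c" using diss[of "x t"] c[of t] by simp
  qed
  then show ?thesis by (simp add: algebra_simps)
qed

text \<open>Gronwall's argument: the squared distance weighted by \<open>exp (- 2 L t)\<close> is
  nonincreasing, nonnegative and 0 at the start. A Lipschitz bound on a set containing both
  trajectories suffices.\<close>

lemma global_solution_unique:
  fixes x y :: "real \<Rightarrow> 'a::euclidean_space"
  assumes x: "global_solution F x0 x" and y: "global_solution F x0 y"
    and lip: "L-lipschitz_on S F"
    and S: "\<And>t. t \<ge> 0 \<Longrightarrow> x t \<in> S" "\<And>t. t \<ge> 0 \<Longrightarrow> y t \<in> S"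
    and "t \<ge> 0"
  shows "y t = x t"
proof -
  let ?w = "\<lambda>t. exp (- (2 * L * t)) * ((x t - y t) \<bullet> (x t - y t))"
  let ?D = "\<lambda>t. exp (- (2 * L * t)) * (2 * ((x t - y t) \<bullet> (F (x t) - F (y t))) - 2 * L * (norm (x t - y t))\<^sup>2)"
  have "(?D has_integral ?w t - ?w 0) {0..t}"
  proof (rule has_integral_within_atLeast)
    fix s :: real assume s: "0 \<le> s"
    have dx: "(x has_vector_derivative F (x s)) (at s within {0..})"
      and dy: "(y has_vector_derivative F (y s)) (at s within {0..})"
      using x y s by (auto simp: global_solution_def)
    have de: "((\<lambda>t. exp (- (2 * L * t))) has_vector_derivative exp (- (2 * L * s)) * (- (2 * L))) (at s within {0..})"
      unfolding has_real_derivative_iff_has_vector_derivative[symmetric]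
      by (auto intro!: derivative_eq_intros)
    have di: "((\<lambda>t. (x t - y t) \<bullet> (x t - y t)) has_vector_derivative
        2 * ((x s - y s) \<bullet> (F (x s) - F (y s)))) (at s within {0..})"
      using bounded_bilinear.has_vector_derivative[OF bounded_bilinear_inner
          has_vector_derivative_diff[OF dx dy] has_vector_derivative_diff[OF dx dy]]
      by (simp add: inner_commute)
    show "(?w has_vector_derivative ?D s) (at s within {0..})"
      using bounded_bilinear.has_vector_derivative[OF bounded_bilinear_mult de di]
      by (simp add: power2_norm_eq_inner algebra_simps)
  qed (use \<open>t \<ge> 0\<close> in auto)
  then have "?w t - ?w 0 \<le> 0"
  proof (rule has_integral_le[OF _ has_integral_0])
    fix s assume "s \<in> {0..t}"
    then have s: "s \<ge> 0" by simp
    have "(x s - y s) \<bullet> (F (x s) - F (y s)) \<le> norm (x s - y s) * norm (F (x s) - F (y s))"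
      by (rule norm_cauchy_schwarz)
    also have "\<dots> \<le> norm (x s - y s) * (L * norm (x s - y s))"
      using lipschitz_onD[OF lip S(1)[OF s] S(2)[OF s]]
      by (intro mult_left_mono) (auto simp: dist_norm)
    finally show "?D s \<le> 0"
      by (intro mult_nonneg_nonpos) (auto simp: power2_eq_square algebra_simps)
  qed
  moreover have "?w 0 = 0" using x y by (simp add: global_solution_def)
  ultimately have "(x t - y t) \<bullet> (x t - y t) \<le> 0"
    by (simp add: mult_le_0_iff)
  then have "(x t - y t) \<bullet> (x t - y t) = 0" using inner_ge_zero antisym by blast
  then show ?thesis by simp
qed

section \<open>Integrability and derivatives on the half-line\<close>

text \<open>Monotone convergence for the truncations of \<open>g\<close> to
  \<open>{0..k}\<close>.\<close>

lemma absolutely_integrable_on_atLeast_bounded: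
  fixes g :: "real \<Rightarrow> real"
  assumes c: "continuous_on {0..} g" and nn: "\<And>t. t \<ge> 0 \<Longrightarrow> g t \<ge> 0"
    and B: "\<And>T. T \<ge> 0 \<Longrightarrow> integral {0..T} g \<le> B"
  shows "g absolutely_integrable_on {0..}"
proof -
  let ?h = "\<lambda>k t. if t \<in> {0..real k} then g t else 0"
  have int: "g integrable_on {0..T}" for T
    by (intro integrable_continuous_real continuous_on_subset[OF c]) auto
  have h: "(?h k has_integral integral {0..real k} g) {0..}" for k
    using integrable_integral[OF int] by (subst has_integral_restrict) auto
  have "g integrable_on {0..} \<and> ((\<lambda>k. integral {0..} (?h k)) \<longlonglongrightarrow> integral {0..} g)"
  proof (rule monotone_convergence_increasing)
    show "?h k integrable_on {0..}" for k using h by blast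
    show "?h k t \<le> ?h (Suc k) t" if "t \<in> {0..}" for k t using nn that by auto
    show "(\<lambda>k. ?h k t) \<longlonglongrightarrow> g t" if "t \<in> {0..}" for t
    proof (rule tendsto_eventually)
      obtain n where "t \<le> real n" using real_arch_simple by blast
      then show "\<forall>\<^sub>F k in sequentially. ?h k t = g t"
        using that by (intro eventually_sequentiallyI[of n]) auto
    qed
    have "integral {0..real k} g \<ge> 0" for k
      using int nn by (intro integral_nonneg) auto
    then have "norm (integral {0..} (?h k)) \<le> B" for k
      unfolding integral_unique[OF h] using B[of "real k"] by simp
    then show "bounded (range (\<lambda>k. integral {0..} (?h k)))"
      by (auto intro: boundedI[of _ B])
  qed
  then show ?thesis
    using nn by (intro nonnegative_absolutely_integrable_1) auto
qed

lemma vector_derivative_global_solution: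
  assumes "global_solution F x0 x" "t \<ge> 0"
  shows "vector_derivative x (at t within {0..}) = F (x t)"
proof (rule vector_derivative_within)
  \<comment> \<open>Every point of the half-line, 0 included, is a limit from the right, so the
    one-sided derivative is unique.\<close>
  have "at_right t \<le> at t within {0..}" using assms(2) by (intro at_le) auto
  then show "at t within {0..} \<noteq> bot"
    using trivial_limit_at_right_real[of t] by (metis bot.extremum_uniqueI)
  show "(x has_vector_derivative F (x t)) (at t within {0..})"
    using assms by (simp add: global_solution_def)
qed

lemma GDERIV_isCont: "GDERIV f x :> D \<Longrightarrow> isCont f x"
  unfolding gderiv_def by (rule has_derivative_continuous)

lemma level_set_in_ball:
  assumes "level_bounded f"
  obtains R where "R > 0" "\<And>x. f x \<le> \<alpha> \<Longrightarrow> norm x < R"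
proof -
  obtain R where "R > 0" "\<And>x. x \<in> {x. f x \<le> \<alpha>} \<Longrightarrow> norm x < R"
    using assms unfolding level_bounded_def bounded_pos_less by blast
  then show ?thesis using that by blast
qed

section \<open>Existence and asymptotics for dissipative fields\<close>

lemma dissipative_solution_exists:
  fixes f :: "'a::euclidean_space \<Rightarrow> real"
  assumes grad: "\<And>x. GDERIV f x :> g x" and lb: "level_bounded f"
    and lip: "\<And>R. \<exists>L. L-lipschitz_on (cball 0 R) F" and "\<mu> > 0"
    and diss: "\<And>x. \<mu> * (norm (F x))\<^sup>2 \<le> - (F x \<bullet> g x)"
  shows "\<exists>x. global_solution F x0 x"
proof -
  obtain R where R: "R > 0" "\<And>x. f x \<le> f x0 \<Longrightarrow> norm x < R"
    using level_set_in_ball[OF lb] by blast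
  obtain L where L: "L-lipschitz_on (cball 0 R) F" using lip by blast
  \<comment> \<open>Precomposing with the projection makes the field bounded and globally Lipschitz; the
    energy keeps the solution in the interior of the ball, where nothing was changed.\<close>
  define \<pi> where "\<pi> = closest_point (cball (0::'a) R)"
  have \<pi>_in: "\<pi> x \<in> cball 0 R" for x
    unfolding \<pi>_def using R(1) by (intro closest_point_in_set) auto
  have \<pi>_id: "\<pi> x = x" if "norm x \<le> R" for x
    unfolding \<pi>_def using that by (intro closest_point_self) simp
  have \<pi>_lip: "dist (\<pi> x) (\<pi> y) \<le> dist x y" for x y
    unfolding \<pi>_def using R(1) by (intro closest_point_lipschitz) auto
  have "compact (F ` cball 0 R)"
    by (intro compact_continuous_image lipschitz_on_continuous_on[OF L]) simp
  then obtain M where M: "\<And>x. x \<in> cball 0 R \<Longrightarrow> norm (F x) \<le> M"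
    by (meson bounded_iff compact_imp_bounded imageI)
  have "L-lipschitz_on UNIV (\<lambda>x. F (\<pi> x))"
  proof (rule lipschitz_onI)
    show L0: "L \<ge> 0" using L by (rule lipschitz_on_nonneg)
    fix x y
    have "dist (F (\<pi> x)) (F (\<pi> y)) \<le> L * dist (\<pi> x) (\<pi> y)"
      by (intro lipschitz_onD[OF L] \<pi>_in)
    also have "\<dots> \<le> L * dist x y" using L0 \<pi>_lip by (intro mult_left_mono)
    finally show "dist (F (\<pi> x)) (F (\<pi> y)) \<le> L * dist x y" .
  qed
  then obtain x where x: "global_solution (\<lambda>x. F (\<pi> x)) x0 x"
    using global_solution_exists_bounded_lipschitz M \<pi>_in by metis
  have x0: "x 0 = x0" using x by (simp add: global_solution_def)
  have stay: "norm (x t) < R" if "t \<ge> 0" for t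
  proof (rule ccontr)
    assume "\<not> norm (x t) < R"
    \<comment> \<open>\<open>B\<close> is closed, so its infimum \<open>\<tau>\<close> is the first
      time at which the norm reaches \<open>R\<close>.\<close>
    define B where "B = {s \<in> {0..}. R \<le> norm (x s)}"
    have "closed B" unfolding B_def
      by (intro continuous_closed_preimage continuous_on_closed_Collect_le
          continuous_on_norm global_solution_continuous[OF x]) auto
    moreover have "B \<noteq> {}" "bdd_below B"
      using that \<open>\<not> norm (x t) < R\<close> by (auto simp: B_def intro: bdd_belowI[of _ 0])
    ultimately have "Inf B \<in> B" by (intro closed_contains_Inf)
    define \<tau> where "\<tau> = Inf B"
    have \<tau>: "\<tau> \<ge> 0" "R \<le> norm (x \<tau>)" using \<open>Inf B \<in> B\<close> by (auto simp: B_def \<tau>_def)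
    have before: "norm (x s) < R" if "0 \<le> s" "s < \<tau>" for s
      using cInf_lower[OF _ \<open>bdd_below B\<close>, of s] that by (force simp: B_def \<tau>_def)
    have "\<tau> \<noteq> 0" using \<tau>(2) R(2)[of x0] x0 by auto
    \<comment> \<open>Continuity from the left puts \<open>x \<tau>\<close> in the closed ball, so
      the projection still fixes it and the original equation holds on all of
      \<open>{0..\<tau>}\<close>.\<close>
    have at: "norm (x \<tau>) \<le> R"
    proof (rule tendsto_upperbound)
      have "continuous (at \<tau> within {0..}) x"
        using global_solution_continuous[OF x] \<tau>(1) by (simp add: continuous_on_eq_continuous_within)
      then have "(x \<longlongrightarrow> x \<tau>) (at \<tau> within {0..<\<tau>})"
        unfolding continuous_within by (rule tendsto_within_subset) auto
      then show "((\<lambda>s. norm (x s)) \<longlongrightarrow> norm (x \<tau>)) (at \<tau> within {0..<\<tau>})"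
        by (rule tendsto_norm)
      show "\<forall>\<^sub>F s in at \<tau> within {0..<\<tau>}. norm (x s) \<le> R"
        using before by (auto simp: eventually_at_filter less_imp_le)
      show "at \<tau> within {0..<\<tau>} \<noteq> bot"
        using \<tau>(1) \<open>\<tau> \<noteq> 0\<close> by (simp add: at_within_eq_bot_iff)
    qed
    \<comment> \<open>Hence \<open>x \<tau>\<close> lies in the sublevel set of \<open>x0\<close>,
      where the norm is strictly less than \<open>R\<close>.\<close>
    have "f (x \<tau>) \<le> f (x 0) - 0 * (\<tau> - 0)"
    proof (rule energy_decrease[OF grad _ _ _ diss])
      fix s assume s: "0 \<le> s" "s \<le> \<tau>"
      then have "norm (x s) \<le> R" using before[of s] at by (cases "s = \<tau>") auto
      then show "(x has_vector_derivative F (x s)) (at s within {0..})"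
        using x s \<pi>_id[of "x s"] by (auto simp: global_solution_def)
    qed (use \<tau> \<open>\<mu> > 0\<close> in auto)
    then show False using R(2)[of "x \<tau>"] \<tau>(2) x0 by simp
  qed
  have "global_solution F x0 x"
    using x stay \<pi>_id by (auto simp: global_solution_def less_imp_le)
  then show ?thesis by blast
qed

text \<open>Every solution from \<open>x0\<close> stays in one ball, on which \<open>F\<close> has a
  single Lipschitz constant and \<open>f\<close> and \<open>F\<close> are bounded; this constant
  gives uniqueness, and the bounds feed the energy estimates.\<close>

lemma dissipative_flow:
  fixes f :: "'a::euclidean_space \<Rightarrow> real"
  assumes grad: "\<And>x. GDERIV f x :> g x" and lb: "level_bounded f"
    and lip: "\<And>R. \<exists>L. L-lipschitz_on (cball 0 R) F" and "\<mu> > 0"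
    and diss: "\<And>x. \<mu> * (norm (F x))\<^sup>2 \<le> - (F x \<bullet> g x)"
  shows "\<exists>x. global_solution F x0 x \<and>
    (\<forall>y. global_solution F x0 y \<longrightarrow> (\<forall>t\<ge>0. y t = x t)) \<and>
    L2_on {0..} (\<lambda>t. vector_derivative x (at t within {0..})) \<and>
    ((\<lambda>t. vector_derivative x (at t within {0..})) \<longlongrightarrow> 0) at_top"
proof -
  obtain x where x: "global_solution F x0 x"
    using dissipative_solution_exists[OF assms] by blast
  obtain R where R: "R > 0" "\<And>x. f x \<le> f x0 \<Longrightarrow> norm x < R"
    using level_set_in_ball[OF lb] by blast
  obtain L where L: "L-lipschitz_on (cball 0 R) F" using lip by blast
  have decr: "f (y b) \<le> f (y a) - c * (b - a)"
    if "global_solution F x0 y" "0 \<le> a" "a \<le> b"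
      "\<And>t. a \<le> t \<Longrightarrow> t \<le> b \<Longrightarrow> c \<le> \<mu> * (norm (F (y t)))\<^sup>2" for y a b c
    using that by (intro energy_decrease[OF grad _ _ _ diss]) (auto simp: global_solution_def)
  have mono: "f (y b) \<le> f (y a)" if "global_solution F x0 y" "0 \<le> a" "a \<le> b" for y a b
    using decr[OF that, of 0] \<open>\<mu> > 0\<close> by simp
  have stay: "y t \<in> cball 0 R" if "global_solution F x0 y" "t \<ge> 0" for y t
    using mono[OF that(1), of 0 t] that R(2)[of "y t"] by (auto simp: global_solution_def)
  have uniq: "y t = x t" if "global_solution F x0 y" "t \<ge> 0" for y t
    using global_solution_unique[OF x that(1) L] stay x that by blast
  have vd: "vector_derivative x (at t within {0..}) = F (x t)" if "t \<ge> 0" for t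
    using vector_derivative_global_solution[OF x that] .
  have contF: "continuous_on {0..} (\<lambda>t. F (x t))"
    using stay[OF x]
    by (intro continuous_on_compose2[OF lipschitz_on_continuous_on[OF L] global_solution_continuous[OF x]]) auto
  have "continuous_on (cball 0 R) f"
    using GDERIV_isCont[OF grad] by (simp add: continuous_at_imp_continuous_on)
  then have "compact (f ` cball 0 R)" by (rule compact_continuous_image) simp
  then obtain m where "\<And>z. z \<in> cball 0 R \<Longrightarrow> \<bar>f z\<bar> \<le> m"
    by (metis bounded_iff compact_imp_bounded imageI real_norm_def)
  then have m: "- m \<le> f (x t)" if "t \<ge> 0" for t
    using stay[OF x that] by (force simp: abs_le_iff)
  have "compact (F ` cball 0 R)"
    by (intro compact_continuous_image lipschitz_on_continuous_on[OF L]) simp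
  then obtain M where M: "\<And>z. z \<in> cball 0 R \<Longrightarrow> norm (F z) \<le> M"
    by (meson bounded_iff compact_imp_bounded imageI)
  have "(\<lambda>t. (norm (F (x t)))\<^sup>2) absolutely_integrable_on {0..}"
  proof (rule absolutely_integrable_on_atLeast_bounded)
    show c: "continuous_on {0..} (\<lambda>t. (norm (F (x t)))\<^sup>2)"
      by (intro continuous_intros contF)
    fix T :: real assume T: "T \<ge> 0"
    have e: "((\<lambda>t. F (x t) \<bullet> g (x t)) has_integral f (x T) - f (x 0)) {0..T}"
      using x T by (intro energy_has_integral[OF grad]) (auto simp: global_solution_def)
    \<comment> \<open>After division by \<open>\<mu>\<close>, dissipation dominates the squared
      speed by the rate of energy loss, whose integral telescopes.\<close>
    have ub: "((\<lambda>t. - (1 / \<mu>) * (F (x t) \<bullet> g (x t))) has_integral - (1 / \<mu>) * (f (x T) - f (x 0))) {0..T}"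
      by (rule has_integral_mult_right[OF e])
    have "((\<lambda>t. (norm (F (x t)))\<^sup>2) has_integral integral {0..T} (\<lambda>t. (norm (F (x t)))\<^sup>2)) {0..T}"
      by (intro integrable_integral integrable_continuous_real continuous_on_subset[OF c]) auto
    then have "integral {0..T} (\<lambda>t. (norm (F (x t)))\<^sup>2) \<le> - (1 / \<mu>) * (f (x T) - f (x 0))"
    proof (rule has_integral_le[OF _ ub])
      fix t
      show "(norm (F (x t)))\<^sup>2 \<le> - (1 / \<mu>) * (F (x t) \<bullet> g (x t))"
        using diss[of "x t"] \<open>\<mu> > 0\<close> by (simp add: field_simps)
    qed
    also have "\<dots> = (1 / \<mu>) * (f (x 0) - f (x T))" by (simp add: algebra_simps)
    also have "\<dots> \<le> (1 / \<mu>) * (f (x 0) + m)"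
      using m[OF T] \<open>\<mu> > 0\<close> by (intro mult_left_mono) auto
    finally show "integral {0..T} (\<lambda>t. (norm (F (x t)))\<^sup>2) \<le> (1 / \<mu>) * (f (x 0) + m)" .
  qed simp
  then have int: "set_integrable lebesgue {0..} (\<lambda>t. (norm (vector_derivative x (at t within {0..})))\<^sup>2)"
    by (rule set_integrable_cong[THEN iffD1, rotated -1]) (auto simp: vd)
  have "(\<lambda>t. indicator {0..} t *\<^sub>R F (x t)) \<in> borel_measurable borel"
    by (intro borel_measurable_continuous_on_indicator contF) simp
  then have "(\<lambda>t. indicator {0..} t *\<^sub>R F (x t)) \<in> borel_measurable lebesgue"
    by (intro measurable_completion) simp
  moreover have "(\<lambda>t. indicator {0..} t *\<^sub>R F (x t))
      = (\<lambda>t. indicator {0..} t *\<^sub>R vector_derivative x (at t within {0..}))"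
    by (auto simp: vd indicator_def fun_eq_iff)
  ultimately have L2: "L2_on {0..} (\<lambda>t. vector_derivative x (at t within {0..}))"
    unfolding L2_on_def set_borel_measurable_def using int by simp
  \<comment> \<open>\<open>L * M\<close> is a Lipschitz constant in time of \<open>F (x t)\<close>,
    since the speed is at most \<open>M\<close>; adding 1 allows the division by \<open>C\<close> in
    \<open>\<delta>\<close>.\<close>
  define C where "C = L * M + 1"
  have L0: "L \<ge> 0" using L by (rule lipschitz_on_nonneg)
  have M0: "M \<ge> 0" using M[of 0] R(1) norm_ge_zero[of "F 0"] by (auto intro: order_trans simp del: norm_ge_zero)
  have C: "C > 0" unfolding C_def using L0 M0 by (simp add: add_nonneg_pos)
  have lipF: "norm (F (x t) - F (x s)) \<le> C * (t - s)" if "0 \<le> s" "s \<le> t" for s t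
  proof -
    have "((\<lambda>t. F (x t)) has_integral x t - x s) {s..t}"
      using that x by (intro has_integral_within_atLeast) (auto simp: global_solution_def)
    then have "norm (x t - x s) \<le> M * (t - s)"
      using has_integral_bound_real[OF M0 finite.emptyI, of "\<lambda>t. F (x t)" "x t - x s" s t]
        M stay[OF x] that by auto
    then have "L * norm (x t - x s) \<le> L * (M * (t - s))" using L0 by (rule mult_left_mono)
    moreover have "norm (F (x t) - F (x s)) \<le> L * norm (x t - x s)"
      using lipschitz_onD[OF L stay[OF x] stay[OF x], of t s] that by (simp add: dist_norm)
    ultimately show ?thesis using that by (simp add: C_def algebra_simps)
  qed
  have small: "\<exists>T\<ge>0. \<forall>s\<ge>T. norm (F (x s)) < \<epsilon>" if "\<epsilon> > 0" for \<epsilon>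
  proof -
    \<comment> \<open>During a time \<open>\<delta>\<close> the velocity changes by at most
      \<open>C * \<delta> = \<epsilon> / 2\<close>, so a speed of \<open>\<epsilon>\<close> stays
      above \<open>\<epsilon> / 2\<close> and the energy drops by at least \<open>c\<close>.\<close>
    define \<delta> where "\<delta> = \<epsilon> / (2 * C)"
    define c where "c = \<mu> * (\<epsilon> / 2)\<^sup>2 * \<delta>"
    have \<delta>: "\<delta> > 0" and c: "c > 0" using that C \<open>\<mu> > 0\<close> by (auto simp: \<delta>_def c_def)
    define J where "J = Inf ((\<lambda>t. f (x t)) ` {0..})"
    have bdd: "bdd_below ((\<lambda>t. f (x t)) ` {0..})" using m by (auto intro: bdd_belowI[of _ "-m"])
    have J: "J \<le> f (x t)" if "t \<ge> 0" for t
      unfolding J_def using that bdd by (intro cInf_lower) auto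
    have "\<exists>z\<in>(\<lambda>t. f (x t)) ` {0..}. z < J + c"
      using c bdd by (subst cInf_less_iff[symmetric]) (auto simp: J_def)
    \<comment> \<open>From time \<open>T\<close> on the energy is within \<open>c\<close> of its
      infimum \<open>J\<close>, so a further drop by \<open>c\<close> would go below
      \<open>J\<close>.\<close>
    then obtain T where T: "T \<ge> 0" "f (x T) < J + c" by auto
    have "norm (F (x s)) < \<epsilon>" if s: "s \<ge> T" for s
    proof (rule ccontr)
      assume big: "\<not> norm (F (x s)) < \<epsilon>"
      have s0: "s \<ge> 0" using s T(1) by simp
      have "f (x (s + \<delta>)) \<le> f (x s) - \<mu> * (\<epsilon> / 2)\<^sup>2 * (s + \<delta> - s)"
      proof (rule decr[OF x s0])
        fix t assume t: "s \<le> t" "t \<le> s + \<delta>"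
        have "norm (F (x t) - F (x s)) \<le> C * (t - s)" using lipF s0 t by simp
        also have "\<dots> \<le> C * \<delta>" using t C by (intro mult_left_mono) auto
        also have "\<dots> = \<epsilon> / 2" using C by (simp add: \<delta>_def)
        finally have "\<epsilon> / 2 \<le> norm (F (x t))"
          using big norm_triangle_ineq2[of "F (x s)" "F (x t)"] norm_minus_commute[of "F (x s)" "F (x t)"]
          by linarith
        then show "\<mu> * (\<epsilon> / 2)\<^sup>2 \<le> \<mu> * (norm (F (x t)))\<^sup>2"
          using \<open>\<epsilon> > 0\<close> \<open>\<mu> > 0\<close> by (intro mult_left_mono power_mono) auto
      qed (use \<delta> in simp)
      also have "\<dots> = f (x s) - c" by (simp add: c_def)
      finally have "f (x (s + \<delta>)) < J" using mono[OF x T(1) s] T(2) by simp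
      then show False using J[of "s + \<delta>"] s0 \<delta> by simp
    qed
    with T(1) show ?thesis by blast
  qed
  have "((\<lambda>t. vector_derivative x (at t within {0..})) \<longlongrightarrow> 0) at_top"
  proof (rule tendstoI)
    fix \<epsilon> :: real assume "\<epsilon> > 0"
    then obtain T where "T \<ge> 0" "\<And>s. s \<ge> T \<Longrightarrow> norm (F (x s)) < \<epsilon>" using small by blast
    then show "\<forall>\<^sub>F t in at_top. dist (vector_derivative x (at t within {0..})) 0 < \<epsilon>"
      by (intro eventually_at_top_linorderI[of T]) (simp add: vd)
  qed
  with x uniq L2 show ?thesis by blast
qed

section \<open>The preconditioned gradient flow\<close>

theorem mainTheorem1:
  fixes f :: "real ^ 'n \<Rightarrow> real"
    and \<phi> :: "real ^ 'n \<Rightarrow> ereal"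
    and \<mu> :: real
    and x0 :: "real ^ 'n"
  assumes "C_k_on 2 UNIV f"
    and "level_bounded f"
    and "proper \<phi>"
    and "lower_semicontinuous \<phi>"
    and "essentially_smooth \<phi>"
    and "\<mu> > 0"
    and "strongly_convex \<mu> \<phi>"
    and "\<And>x. \<phi> x \<ge> 0"
    and "\<And>x. \<phi> (- x) = \<phi> x"
    and "\<phi> 0 = 0"
  defines "F \<equiv> \<lambda>z. - gradient (\<lambda>y. real_of_ereal (convex_conjugate \<phi> y)) (gradient f z)"
  shows "\<exists>x. global_solution F x0 x \<and>
           (\<forall>y. global_solution F x0 y \<longrightarrow> (\<forall>t\<ge>0. y t = x t)) \<and>
           L2_on {0..} (\<lambda>t. vector_derivative x (at t within {0..})) \<and>
           (C_k_on 2 (interior (effective_domain \<phi>)) (\<lambda>z. real_of_ereal (\<phi> z)) \<longrightarrow>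
              ((\<lambda>t. vector_derivative x (at t within {0..})) \<longlongrightarrow> 0) at_top)"
proof -
  define P where "P = gradient (\<lambda>y. real_of_ereal (convex_conjugate \<phi> y))"
  have F: "F z = - P (gradient f z)" for z by (simp add: F_def P_def)
  note P_props = convex_conjugate_gradient[OF \<open>strongly_convex \<mu> \<phi>\<close> \<open>lower_semicontinuous \<phi>\<close>
      \<open>\<mu> > 0\<close> assms(8) \<open>\<phi> 0 = 0\<close>, folded P_def]
  \<comment> \<open>\<open>F\<close> composes the globally Lipschitz gradient of the conjugate with
    \<open>gradient f\<close>, which is Lipschitz on each ball.\<close>
  have "\<exists>L. L-lipschitz_on (cball 0 R) F" for R
  proof -
    obtain L where L: "L-lipschitz_on (cball 0 R) (gradient f)"
      using C_2_gradient_lipschitz_on_cball[OF \<open>C_k_on 2 UNIV f\<close>] by blast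
    have "(L / \<mu>)-lipschitz_on (cball 0 R) F"
    proof (rule lipschitz_onI)
      show "0 \<le> L / \<mu>" using lipschitz_on_nonneg[OF L] \<open>\<mu> > 0\<close> by simp
      fix x y :: "real ^ 'n" assume xy: "x \<in> cball 0 R" "y \<in> cball 0 R"
      have "dist (F x) (F y) = norm (P (gradient f x) - P (gradient f y))"
        by (simp add: F dist_norm norm_minus_commute)
      also have "\<dots> \<le> norm (gradient f x - gradient f y) / \<mu>" by (rule P_props(2))
      also have "\<dots> \<le> L * dist x y / \<mu>"
        using lipschitz_onD[OF L xy] \<open>\<mu> > 0\<close> by (intro divide_right_mono) (auto simp: dist_norm)
      finally show "dist (F x) (F y) \<le> L / \<mu> * dist x y" by simp
    qed
    then show ?thesis by blast
  qed
  \<comment> \<open>This is the coercivity of the conjugate's gradient at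
    \<open>gradient f z\<close>; the sign in \<open>F\<close> turns it into dissipation.\<close>
  moreover have "\<mu> * (norm (F z))\<^sup>2 \<le> - (F z \<bullet> gradient f z)" for z
    using P_props(1)[of "gradient f z"] by (simp add: F inner_commute)
  ultimately show ?thesis
    using dissipative_flow[OF C_k_on_2_GDERIV(1)[OF \<open>C_k_on 2 UNIV f\<close>] \<open>level_bounded f\<close> _ \<open>\<mu> > 0\<close>]
    by blast
qed

end
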